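(* For every integer $n\geq 3$, writing $f_q(n)$ for the total number of occurrences of the pattern $q$ in all permutations of $S_n(123,231,312)$, we have $$f_{132}(n)=f_{213}(n)=\binom{n+1}{4},\qquad f_{321}(n)=\frac{n(n-2)(n-1)^2}{12}.$$
   Context: $S_n$ is the set of permutations of $\{1,\dots,n\}$ written in one-line notation $\sigma=\sigma_1\sigma_2\cdots\sigma_n$. For $q\in S_k$, an occurrence of the pattern $q$ in $\sigma\in S_n$ is a choice of indices $i_1<i_2<\cdots<i_k$ in $\{1,\dots,n\}$ such that for all $1\le j,l\le k$, $q_j<q_l$ if and only if $\sigma_{i_j}<\sigma_{i_l}$. Let $f_q(\sigma)$ be the number of occurrences of $q$ in $\sigma$; $\sigma$ avoids $q$ if $f_q(\sigma)=0$. $S_n(123,231,312)$ is the set of permutations in $S_n$ avoiding all of $123$, $231$ and $312$, and $f_q(n)=\sum_{\sigma\in S_n(123,231,312)}f_q(\sigma)$. *)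

theory Defs
  imports Complex_Main "HOL-Combinatorics.Multiset_Permutations"
begin

text \<open>Permutations are lists in one-line notation. List positions count from 0, so the
  indices of an occurrence range over \<open>{..<n}\<close> instead of \<open>{1..n}\<close>.\<close>

definition perms :: "nat \<Rightarrow> nat list set" where
  "perms n = permutations_of_set {1..n}"

definition occurrences :: "nat list \<Rightarrow> nat list \<Rightarrow> nat list set" where
  "occurrences q \<sigma> = {is. length is = length q \<and> set is \<subseteq> {..<length \<sigma>} \<and> sorted_wrt (<) is \<and>
     (\<forall>j<length q. \<forall>l<length q. q ! j < q ! l \<longleftrightarrow> \<sigma> ! (is ! j) < \<sigma> ! (is ! l))}"

lemma finite_occurrences: "finite (occurrences q \<sigma>)"
  unfolding occurrences_def
  by (rule finite_subset[OF _ finite_lists_length_eq[of "{..<length \<sigma>}" "length q"]]) auto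

definition num_occ :: "nat list \<Rightarrow> nat list \<Rightarrow> nat" where
  "num_occ q \<sigma> = card (occurrences q \<sigma>)"

definition avoids :: "nat list \<Rightarrow> nat list \<Rightarrow> bool" where
  "avoids \<sigma> q \<longleftrightarrow> num_occ q \<sigma> = 0"

definition avoiders :: "nat list set \<Rightarrow> nat \<Rightarrow> nat list set" where
  "avoiders Q n = {\<sigma> \<in> perms n. \<forall>q\<in>Q. avoids \<sigma> q}"

definition total_occ :: "nat list \<Rightarrow> nat \<Rightarrow> nat" where
  "total_occ q n = (\<Sum>\<sigma>\<in>avoiders {[1,2,3], [2,3,1], [3,1,2]} n. num_occ q \<sigma>)"

end

theory Submission
  imports Defs
begin

text \<open>A permutation avoiding 123, 231 and 312 is determined by its first entry \<open>k\<close>: the smaller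
  entries must decrease (else 312), the larger ones must decrease (else 123), and every smaller
  entry must precede every larger one (else 231). So the permutation is \<open>k\<dots>1 n\<dots>(k+1)\<close>, and all
  these permutations do avoid the three patterns. In such a permutation an occurrence of 132 is
  one entry of the first block with two of the second, of 213 two entries of the first block with
  one of the second, and of 321 three entries of one block. Summing over \<open>k\<close> is the
  Chu--Vandermonde identity for upper indices.\<close>

section \<open>Binomial sums and increasing lists\<close>

text \<open>Counts the subsets of \<open>{0..n}\<close> with \<open>a + b + 1\<close> elements by
  the element \<open>k\<close> that has exactly \<open>a\<close> elements below it. The induction
  keeps \<open>b\<close> arbitrary because Pascal's rule on the second factor lowers it.\<close>

lemma sum_choose_mult_choose:
  "(\<Sum>k\<le>n. (k choose a) * (n - k choose b)) = Suc n choose (Suc (a + b))"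
proof (induction n arbitrary: b)
  case 0
  then show ?case by (cases a; cases b) auto
next
  case (Suc n)
  show ?case
  proof (cases b)
    case 0
    then show ?thesis using sum_choose_upper[of a "Suc n"] by (simp add: atMost_atLeast0)
  next
    case (Suc c)
    \<comment> \<open>As \<open>b\<close> is positive, the term \<open>k = Suc n\<close>
      vanishes.\<close>
    have "(\<Sum>k\<le>Suc n. (k choose a) * (Suc n - k choose b))
      = (\<Sum>k\<le>n. (k choose a) * (Suc (n - k) choose Suc c))"
      using Suc by (simp add: Suc_diff_le)
    also have "\<dots> = (\<Sum>k\<le>n. (k choose a) * (n - k choose c))
        + (\<Sum>k\<le>n. (k choose a) * (n - k choose Suc c))"
      by (simp add: sum.distrib[symmetric] algebra_simps)
    also have "\<dots> = Suc (Suc n) choose Suc (a + b)"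
      using Suc.IH[of c] Suc.IH[of "Suc c"] Suc by simp
    finally show ?thesis .
  qed
qed

definition inc_lists :: "nat \<Rightarrow> nat set \<Rightarrow> nat list set" where
  "inc_lists m A = {xs. length xs = m \<and> set xs \<subseteq> A \<and> sorted_wrt (<) xs}"

lemma finite_inc_lists: "finite A \<Longrightarrow> finite (inc_lists m A)"
  unfolding inc_lists_def
  by (rule finite_subset[OF _ finite_lists_length_eq[of A m]]) auto

text \<open>A strictly increasing list is determined by its set of entries, so these lists encode
  the \<open>m\<close>-subsets of \<open>A\<close>.\<close>

lemma card_inc_lists:
  assumes "finite A"
  shows "card (inc_lists m A) = card A choose m"
proof -
  have "bij_betw set (inc_lists m A) {B. B \<subseteq> A \<and> card B = m}"
  proof (rule bij_betw_byWitness[where f' = sorted_list_of_set])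
    show "\<forall>xs\<in>inc_lists m A. sorted_list_of_set (set xs) = xs"
      by (auto simp: inc_lists_def sorted_list_of_set.idem_if_sorted_distinct strict_sorted_iff)
    show "\<forall>B\<in>{B. B \<subseteq> A \<and> card B = m}. set (sorted_list_of_set B) = B"
      using assms by (auto dest: finite_subset)
    show "set ` inc_lists m A \<subseteq> {B. B \<subseteq> A \<and> card B = m}"
      by (auto simp: inc_lists_def strict_sorted_iff distinct_card)
    show "sorted_list_of_set ` {B. B \<subseteq> A \<and> card B = m} \<subseteq> inc_lists m A"
      by (auto simp: inc_lists_def finite_subset[OF _ assms])
  qed
  then show ?thesis
    using n_subsets[OF assms, of m] by (simp add: bij_betw_same_card)
qed

section \<open>Occurrences of patterns of length three\<close>

text \<open>The off-diagonal instances of the condition in \<open>occurrences\<close>; the diagonal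
  ones hold trivially.\<close>

definition same_order :: "nat \<Rightarrow> nat \<Rightarrow> nat \<Rightarrow> nat \<Rightarrow> nat \<Rightarrow> nat \<Rightarrow> bool" where
  "same_order x y z u v w \<longleftrightarrow>
     (x < y \<longleftrightarrow> u < v) \<and> (y < x \<longleftrightarrow> v < u) \<and> (x < z \<longleftrightarrow> u < w) \<and> (z < x \<longleftrightarrow> w < u) \<and>
     (y < z \<longleftrightarrow> v < w) \<and> (z < y \<longleftrightarrow> w < v)"

lemma occurrences_3:
  "occurrences [x,y,z] \<sigma> = {[a,b,c] | a b c. a < b \<and> b < c \<and> c < length \<sigma> \<and>
     same_order x y z (\<sigma> ! a) (\<sigma> ! b) (\<sigma> ! c)}"
proof -
  have all: "(\<forall>j<length [x,y,z]. P j) \<longleftrightarrow> P 0 \<and> P 1 \<and> P 2" for P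
    by (auto simp: less_Suc_eq numeral_2_eq_2)
  have len: "length is = length [x,y,z] \<longleftrightarrow> (\<exists>a b c. is = [a,b,c])" for "is" :: "nat list"
    by (auto simp: length_Suc_conv)
  have iff: "[a,b,c] \<in> occurrences [x,y,z] \<sigma> \<longleftrightarrow> a < b \<and> b < c \<and> c < length \<sigma> \<and>
     same_order x y z (\<sigma> ! a) (\<sigma> ! b) (\<sigma> ! c)" for a b c
    unfolding occurrences_def mem_Collect_eq all same_order_def by simp linarith
  show ?thesis (is "?L = ?R")
  proof
    show "?L \<subseteq> ?R"
    proof
      fix "is" assume "is": "is \<in> ?L"
      then have "length is = length [x,y,z]" by (simp add: occurrences_def)
      then obtain a b c where abc: "is = [a,b,c]" unfolding len by blast
      with "is" iff show "is \<in> ?R" by simp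
    qed
    show "?R \<subseteq> ?L"
      by (rule subsetI, elim CollectE exE conjE) (simp add: iff)
  qed
qed

lemma avoids_3:
  assumes "avoids \<sigma> [x,y,z]" "a < b" "b < c" "c < length \<sigma>"
  shows "\<not> same_order x y z (\<sigma> ! a) (\<sigma> ! b) (\<sigma> ! c)"
proof -
  \<comment> \<open>Finiteness matters: \<open>card\<close> is 0 on infinite sets too.\<close>
  have "occurrences [x,y,z] \<sigma> = {}"
    using assms(1) finite_occurrences by (simp add: avoids_def num_occ_def)
  then show ?thesis using assms(2-4) unfolding occurrences_3 by blast
qed

section \<open>The avoiders\<close>

text \<open>In the second block the entry is \<open>n - (i - k)\<close>, written with a single
  subtraction on naturals.\<close>

definition two_block_entry :: "nat \<Rightarrow> nat \<Rightarrow> nat \<Rightarrow> nat" where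
  "two_block_entry n k i = (if i < k then k - i else n + k - i)"

definition two_block_pos :: "nat \<Rightarrow> nat \<Rightarrow> nat \<Rightarrow> nat" where
  "two_block_pos n k v = (if v \<le> k then k - v else n + k - v)"

definition two_block :: "nat \<Rightarrow> nat \<Rightarrow> nat list" where
  "two_block n k = map (two_block_entry n k) [0..<n]"

lemma length_two_block [simp]: "length (two_block n k) = n"
  by (simp add: two_block_def)

lemma nth_two_block: "i < n \<Longrightarrow> two_block n k ! i = (if i < k then k - i else n + k - i)"
  by (simp add: two_block_def two_block_entry_def)

lemma two_block_entry_in: "k \<le> n \<Longrightarrow> i < n \<Longrightarrow> two_block_entry n k i \<in> {1..n}"
  by (auto simp: two_block_entry_def)

lemma two_block_pos_less: "k \<le> n \<Longrightarrow> v \<in> {1..n} \<Longrightarrow> two_block_pos n k v < n"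
  by (simp add: two_block_pos_def) linarith

lemma two_block_pos_entry:
  assumes "k \<le> n" "i < n"
  shows "two_block_pos n k (two_block_entry n k i) = i"
proof (cases "i < k")
  case False
  then have "\<not> n + k - i \<le> k" using assms by linarith
  then show ?thesis using False assms by (simp add: two_block_pos_def two_block_entry_def)
qed (simp add: two_block_pos_def two_block_entry_def)

lemma two_block_entry_pos:
  assumes "k \<le> n" "v \<in> {1..n}"
  shows "two_block_entry n k (two_block_pos n k v) = v"
proof (cases "v \<le> k")
  case False
  then have "\<not> n + k - v < k" using assms by simp
  then show ?thesis using False assms by (simp add: two_block_pos_def two_block_entry_def)
qed (use assms in \<open>simp add: two_block_pos_def two_block_entry_def\<close>)

lemma two_block_in_perms:
  assumes "k \<le> n"
  shows "two_block n k \<in> perms n"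
proof -
  have "bij_betw (two_block_entry n k) {0..<n} {1..n}"
    by (rule bij_betw_byWitness[where f' = "two_block_pos n k"])
      (use assms two_block_entry_in two_block_pos_less two_block_pos_entry two_block_entry_pos
        in \<open>auto simp del: atLeastAtMost_iff\<close>)
  then show ?thesis
    unfolding perms_def
    by (intro permutations_of_setI) (simp_all add: two_block_def distinct_map bij_betw_def)
qed

text \<open>The first entry is \<open>k\<close>. The index 0 is excluded because
  \<open>two_block n 0 = two_block n n\<close>.\<close>

lemma inj_on_two_block: "inj_on (two_block n) {1..n}"
proof (rule inj_onI)
  fix k l assume kl: "k \<in> {1..n}" "l \<in> {1..n}" "two_block n k = two_block n l"
  then have "two_block n k ! 0 = two_block n l ! 0" by simp
  then show "k = l" using kl(1,2) by (simp add: nth_two_block)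
qed

text \<open>An ascent must cross from the first block to the second, which rules out 123. In 231 and
  312 the first entry exceeds the last, so all three positions lie in one block, where no ascent
  exists.\<close>

lemma two_block_avoids:
  assumes "k \<le> n" "q \<in> {[1,2,3], [2,3,1], [3,1,2]}"
  shows "avoids (two_block n k) q"
proof -
  have "occurrences q (two_block n k) = {}"
    using assms by (auto simp: occurrences_3 same_order_def nth_two_block split: if_splits)
  then show ?thesis by (simp add: avoids_def num_occ_def)
qed

lemma avoider_eq_two_block:
  assumes "n > 0" "\<sigma> \<in> avoiders {[1,2,3], [2,3,1], [3,1,2]} n"
  shows "\<exists>k\<in>{1..n}. \<sigma> = two_block n k"
proof -
  define k where "k = \<sigma> ! 0"
  let ?pos = "two_block_pos n k"
  have "\<sigma> \<in> permutations_of_set {1..n}"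
    using assms(2) unfolding avoiders_def perms_def by blast
  then have dist: "distinct \<sigma>" and set: "set \<sigma> = {1..n}"
    by (simp_all add: permutations_of_setD)
  have len: "length \<sigma> = n" using distinct_card[OF dist] set by simp
  have neq: "\<sigma> ! i \<noteq> \<sigma> ! j" if "i < j" "j < n" for i j
    using that by (simp add: nth_eq_iff_index_eq[OF dist] len)
  have range: "\<sigma> ! i \<in> {1..n}" if "i < n" for i
    using that nth_mem[of i \<sigma>] by (simp add: set len)
  have k: "k \<in> {1..n}" using range assms(1) by (simp add: k_def)
  have av: "avoids \<sigma> [1,2,3]" "avoids \<sigma> [2,3,1]" "avoids \<sigma> [3,1,2]"
    using assms(2) unfolding avoiders_def by blast+
  \<comment> \<open>Reading \<sigma> through the position map of the target must give
    \<open>0, 1, ..., n - 1\<close>, so it suffices that positions increase.\<close>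
  have mono: "?pos (\<sigma> ! i) < ?pos (\<sigma> ! j)" if ij: "i < j" "j < n" for i j
  proof (cases "i = 0")
    case True
    then show ?thesis
      using neq[OF ij] range[of j] ij k by (auto simp: two_block_pos_def k_def)
  next
    case False
    then have "\<sigma> ! i \<noteq> k" "\<sigma> ! j \<noteq> k" "\<sigma> ! i \<noteq> \<sigma> ! j"
      using neq[of 0 i] neq[of 0 j] neq[of i j] ij by (auto simp: k_def)
    \<comment> \<open>With \<open>k\<close> as first entry of the triple, 123 handles two larger
      entries, 312 two smaller ones, and 231 a larger entry before a smaller one.\<close>
    then show ?thesis
      using avoids_3[OF av(1), of 0 i j] avoids_3[OF av(2), of 0 i j] avoids_3[OF av(3), of 0 i j]
        False ij len range[of i] range[of j]
      by (auto simp: same_order_def two_block_pos_def k_def[symmetric])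
  qed
  have bij: "bij_betw ?pos {1..n} {0..<n}"
    by (rule bij_betw_byWitness[where f' = "two_block_entry n k"])
      (use k two_block_entry_in two_block_pos_less two_block_pos_entry two_block_entry_pos
        in auto)
  have "map ?pos \<sigma> = [0..<n]"
  proof (rule strict_sorted_equal)
    show "sorted_wrt (<) (map ?pos \<sigma>)"
      using mono len by (simp add: sorted_wrt_iff_nth_less)
    show "set (map ?pos \<sigma>) = set [0..<n]"
      using bij set by (simp add: bij_betw_def)
  qed simp
  then have "two_block n k = map (two_block_entry n k) (map ?pos \<sigma>)"
    by (simp add: two_block_def)
  also have "\<dots> = \<sigma>"
    unfolding map_map using set k by (intro map_idI) (auto simp: two_block_entry_pos)
  finally show ?thesis using k by metis
qed

lemma avoiders_eq_two_block:
  assumes "n > 0"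
  shows "avoiders {[1,2,3], [2,3,1], [3,1,2]} n = two_block n ` {1..n}"
proof
  show "avoiders {[1,2,3], [2,3,1], [3,1,2]} n \<subseteq> two_block n ` {1..n}"
    using avoider_eq_two_block[OF assms] by blast
  show "two_block n ` {1..n} \<subseteq> avoiders {[1,2,3], [2,3,1], [3,1,2]} n"
  proof clarify
    fix k assume "k \<in> {1..n}"
    then have "k \<le> n" by simp
    then show "two_block n k \<in> avoiders {[1,2,3], [2,3,1], [3,1,2]} n"
      using two_block_in_perms two_block_avoids unfolding avoiders_def by blast
  qed
qed

lemma total_occ_eq_sum:
  "n > 0 \<Longrightarrow> total_occ q n = (\<Sum>k=1..n. num_occ q (two_block n k))"
  by (simp only: total_occ_def avoiders_eq_two_block sum.reindex[OF inj_on_two_block] o_def)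

section \<open>Counting occurrences\<close>

text \<open>Both ascents from the entry playing 1 cross the blocks. The factor
  \<open>k choose 1\<close> is left unsimplified to fit
  \<open>sum_choose_mult_choose\<close>.\<close>

lemma num_occ_132_two_block:
  assumes "k \<le> n"
  shows "num_occ [1,3,2] (two_block n k) = (k choose 1) * (n - k choose 2)"
proof -
  have "occurrences [1,3,2] (two_block n k)
      = (\<lambda>(a, bs). a # bs) ` ({..<k} \<times> inc_lists 2 {k..<n})"
    using assms unfolding occurrences_3
    by (auto simp: inc_lists_def same_order_def nth_two_block numeral_2_eq_2 length_Suc_conv image_iff
        split: if_splits)
  moreover have "inj_on (\<lambda>(a, bs). a # bs) ({..<k} \<times> inc_lists 2 {k..<n})"
    by (auto simp: inj_on_def)
  ultimately show ?thesis
    by (simp add: num_occ_def card_image card_cartesian_product card_inc_lists)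
qed

lemma num_occ_213_two_block:
  assumes "k \<le> n"
  shows "num_occ [2,1,3] (two_block n k) = (k choose 2) * (n - k choose 1)"
proof -
  have "occurrences [2,1,3] (two_block n k)
      = (\<lambda>(bs, c). bs @ [c]) ` (inc_lists 2 {..<k} \<times> {k..<n})"
    using assms unfolding occurrences_3
    by (auto simp: inc_lists_def same_order_def nth_two_block numeral_2_eq_2 length_Suc_conv image_iff
        split: if_splits)
  moreover have "inj_on (\<lambda>(bs, c). bs @ [c]) (inc_lists 2 {..<k} \<times> {k..<n})"
    by (auto simp: inj_on_def)
  ultimately show ?thesis
    by (simp add: num_occ_def card_image card_cartesian_product card_inc_lists)
qed

lemma num_occ_321_two_block:
  assumes "k \<le> n"
  shows "num_occ [3,2,1] (two_block n k) = (k choose 3) + (n - k choose 3)"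
proof -
  have "occurrences [3,2,1] (two_block n k) = inc_lists 3 {..<k} \<union> inc_lists 3 {k..<n}"
    using assms unfolding occurrences_3
    by (auto simp: inc_lists_def same_order_def nth_two_block numeral_3_eq_3 length_Suc_conv split: if_splits)
  \<comment> \<open>The lists have length 3, so none is empty and none fits in both blocks.\<close>
  moreover have "inc_lists 3 {..<k} \<inter> inc_lists 3 {k..<n} = {}"
    by (auto simp: inc_lists_def numeral_3_eq_3 length_Suc_conv)
  ultimately show ?thesis
    by (simp add: num_occ_def card_Un_disjoint finite_inc_lists card_inc_lists)
qed

text \<open>Valid also for \<open>n < 4\<close>, where both sides vanish.\<close>

lemma real_choose_4: "real (n choose 4) = real n * (real n - 1) * (real n - 2) * (real n - 3) / 24"
  by (simp add: binomial_gbinomial gbinomial_prod_rev numeral_eq_Suc prod.atLeast0_lessThan_Suc)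

theorem theorem3p8:
  fixes n :: nat
  assumes "n \<ge> 3"
  shows "total_occ [1,3,2] n = (n + 1) choose 4 \<and> total_occ [2,1,3] n = (n + 1) choose 4 \<and>
    real (total_occ [3,2,1] n) = real n * (real n - 2) * (real n - 1)\<^sup>2 / 12"
proof (intro conjI)
  have n: "n > 0" using assms by simp
  \<comment> \<open>The binomial identity starts at \<open>k = 0\<close>, the family of avoiders at
    \<open>k = 1\<close>.\<close>
  have split: "(\<Sum>k\<le>n. f k) = f 0 + (\<Sum>k=1..n. f k)" for f :: "nat \<Rightarrow> nat"
    by (simp add: atMost_atLeast0 sum.atLeast_Suc_atMost)
  have "total_occ [1,3,2] n = (\<Sum>k=1..n. (k choose 1) * (n - k choose 2))"
    unfolding total_occ_eq_sum[OF n] by (intro sum.cong refl num_occ_132_two_block) simp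
  then show "total_occ [1,3,2] n = (n + 1) choose 4"
    using sum_choose_mult_choose[of 1 n 2] by (simp add: split eval_nat_numeral)
  have "total_occ [2,1,3] n = (\<Sum>k=1..n. (k choose 2) * (n - k choose 1))"
    unfolding total_occ_eq_sum[OF n] by (intro sum.cong refl num_occ_213_two_block) simp
  then show "total_occ [2,1,3] n = (n + 1) choose 4"
    using sum_choose_mult_choose[of 2 n 1] by (simp add: split eval_nat_numeral)
  have "total_occ [3,2,1] n = (\<Sum>k=1..n. (k choose 3) + (n - k choose 3))"
    unfolding total_occ_eq_sum[OF n] by (intro sum.cong refl num_occ_321_two_block) simp
  moreover have "(\<Sum>k=1..n. k choose 3) = (n + 1) choose 4"
    using sum_choose_mult_choose[of 3 n 0] by (simp add: split eval_nat_numeral)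
  \<comment> \<open>Here the term at \<open>k = 0\<close> is \<open>n choose 3\<close>; removing it
    from \<open>(n + 1) choose 4\<close> leaves \<open>n choose 4\<close> by Pascal's rule.\<close>
  moreover have "(\<Sum>k=1..n. n - k choose 3) = n choose 4"
    using sum_choose_mult_choose[of 0 n 3] by (simp add: split eval_nat_numeral)
  ultimately have "total_occ [3,2,1] n = ((n + 1) choose 4) + (n choose 4)"
    by (simp add: sum.distrib)
  \<comment> \<open>The common factor \<open>n (n - 1) (n - 2) / 24\<close> multiplies
    \<open>(n + 1) + (n - 3) = 2 (n - 1)\<close>.\<close>
  then show "real (total_occ [3,2,1] n) = real n * (real n - 2) * (real n - 1)\<^sup>2 / 12"
    by (simp add: real_choose_4 field_simps power2_eq_square)
qed

end
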